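(* Let $((V_1,W_1),(V_2,W_2))\in\mathrm{Adm}(E)$. Then the map $$\Xi((V_1,W_1),(V_2,W_2))=\tilde{DV}((V_1,W_1),(V_2,W_2))\circ\tilde{DV}((V_1,W_2),(V_2,W_1))$$ is in $GL(E)$ and satisfies $\Xi((V_1,W_1),(V_2,W_2))|_{V_1}=Id_{V_1}$. Moreover the map $\Xi:\mathrm{Adm}(E)\to GL(E)$ is smooth.
   Context: A map between diffeological spaces is smooth if it sends plots to plots by composition. Subsets carry the subset diffeology, products the product diffeology. Vector spaces and algebras are over $\mathbb{R}$ or $\mathbb{C}$; a diffeological vector space (resp. algebra) is one whose operations are smooth. Let $E$ be a diffeological vector space. $L(E)$ is the space of smooth linear maps $E\to E$ with the functional diffeology: $\rho:O\to L(E)$ is a plot iff for every plot $c$ of $E$ the map $(x,y)\mapsto\rho(y)(c(x))$ is a plot of $E$. $GL(E)$ is the group of smooth linear bijections of $E$ with smooth inverse; $g:O\to GL(E)$ is a plot iff both $g$ and $y\mapsto g(y)^{-1}$ are plots of $L(E)$. Let $A$ be a unital diffeological algebra acting smoothly on $E$ (e.g. $A=L(E)$). Let $\mathbf{P}(A)=\{p\in A: p^2=p\}$ with the subset diffeology. $\mathbf{Spl}(A)$ is the set of pairs $(V,W)$ of linear subspaces of $E$ such that $V=\mathrm{Im}(p)$, $W=\mathrm{Ker}(p)$ for some $p\in\mathbf{P}(A)$. It carries the push-forward diffeology under $p\mapsto(\mathrm{Im}\,p,\mathrm{Ker}\,p)$: plots are the maps locally of the form $r\mapsto(\mathrm{Im}\,p(r),\mathrm{Ker}\,p(r))$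 with $p$ a plot of $\mathbf{P}(A)$. For $(V,W)\in\mathbf{Spl}(A)$, $p_{(V,W)}\in L(E)$ is the projection onto $V$ parallel to $W$. A couple $((V_1,W_1),(V_2,W_2))\in\mathbf{Spl}(A)^2$ is admissible if $((V_1,W_2),(V_2,W_1))\in\mathbf{Spl}(A)^2$. The set of admissible couples is $\mathrm{Adm}(E)$, with the subset diffeology of $\mathbf{Spl}(A)^2$. Put $$DV(V_1,W_1,V_2,W_2)=p_{(V_1,W_2)}\circ p_{(V_2,W_1)}|_{V_1},\qquad \Phi((V_1,W_1),(V_2,W_2))=DV(V_1,W_1,V_2,W_2)\circ p_{(V_1,W_1)}\in L(E),$$ $$\tilde{DV}((V_1,W_1),(V_2,W_2))=\Phi((V_1,W_1),(V_2,W_2))+\Phi((W_1,V_1),(W_2,V_2)).$$ *)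

theory Defs
  imports "HOL-Analysis.Analysis" "HOL-Algebra.Ring"
begin

section \<open>Smooth maps on open subsets of Euclidean spaces\<close>

text \<open>
  The dimension of the domain of a plot is arbitrary, so the n-dimensional space is
  \<^term>\<open>Euclidean_space n\<close>: functions \<^typ>\<open>nat \<Rightarrow> real\<close> vanishing at all
  indices \<open>\<ge> n\<close>. In \<^term>\<open>x(i := t)\<close> below only the \<open>i\<close>-th coordinate varies, so
  \<open>g\<close> is the \<open>i\<close>-th partial derivative of \<open>f\<close>; since the set \<open>U\<close> is open, the
  values of \<open>f\<close> outside \<open>U\<close> are irrelevant.
\<close>

primrec C_k :: "nat \<Rightarrow> nat \<Rightarrow> (nat \<Rightarrow> real) set \<Rightarrow> ((nat \<Rightarrow> real) \<Rightarrow> real) \<Rightarrow> bool" where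
  "C_k 0 n U f \<longleftrightarrow> continuous_map (subtopology (Euclidean_space n) U) euclideanreal f"
| "C_k (Suc k) n U f \<longleftrightarrow>
     continuous_map (subtopology (Euclidean_space n) U) euclideanreal f \<and>
     (\<forall>i<n. \<exists>g. (\<forall>x\<in>U. ((\<lambda>t. f (x(i := t))) has_real_derivative g x) (at (x i))) \<and> C_k k n U g)"

definition C_inf :: "nat \<Rightarrow> (nat \<Rightarrow> real) set \<Rightarrow> ((nat \<Rightarrow> real) \<Rightarrow> real) \<Rightarrow> bool" where
  "C_inf n U f \<longleftrightarrow> openin (Euclidean_space n) U \<and> (\<forall>k. C_k k n U f)"

definition C_inf_map ::
  "nat \<Rightarrow> (nat \<Rightarrow> real) set \<Rightarrow> nat \<Rightarrow> (nat \<Rightarrow> real) set \<Rightarrow> ((nat \<Rightarrow> real) \<Rightarrow> (nat \<Rightarrow> real)) \<Rightarrow> bool" where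
  "C_inf_map m U n V h \<longleftrightarrow>
     openin (Euclidean_space m) U \<and> openin (Euclidean_space n) V \<and> h ` U \<subseteq> V \<and>
     (\<forall>i<n. C_inf m U (\<lambda>x. h x i))"


section \<open>Diffeological spaces\<close>

text \<open>
  A diffeology \<open>D\<close> is given by its plots: \<open>D n U f\<close> says that \<open>f\<close>, restricted to the
  open set \<open>U\<close> of the n-dimensional space, is a plot. As HOL functions are total,
  axiom \<open>plot_cong\<close> states that only the values on \<open>U\<close> count.
\<close>

type_synonym 'a diffeology = "nat \<Rightarrow> (nat \<Rightarrow> real) set \<Rightarrow> ((nat \<Rightarrow> real) \<Rightarrow> 'a) \<Rightarrow> bool"

locale diffeological_space =
  fixes X :: "'a set" and D :: "'a diffeology"
  assumes plot_open: "D n U f \<Longrightarrow> openin (Euclidean_space n) U"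
    and plot_range: "D n U f \<Longrightarrow> f ` U \<subseteq> X"
    and plot_cong: "D n U f \<Longrightarrow> (\<And>x. x \<in> U \<Longrightarrow> f x = g x) \<Longrightarrow> D n U g"
    and plot_const: "openin (Euclidean_space n) U \<Longrightarrow> a \<in> X \<Longrightarrow> D n U (\<lambda>_. a)"
    and plot_local: "openin (Euclidean_space n) U \<Longrightarrow>
      (\<And>x. x \<in> U \<Longrightarrow> \<exists>V. x \<in> V \<and> V \<subseteq> U \<and> D n V f) \<Longrightarrow> D n U f"
    and plot_comp: "D n V f \<Longrightarrow> C_inf_map m U n V h \<Longrightarrow> D m U (f \<circ> h)"

definition diff_smooth :: "'a diffeology \<Rightarrow> 'b diffeology \<Rightarrow> ('a \<Rightarrow> 'b) \<Rightarrow> bool" where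
  "diff_smooth D1 D2 f \<longleftrightarrow> (\<forall>n U c. D1 n U c \<longrightarrow> D2 n U (f \<circ> c))"

definition sub_diff :: "'a diffeology \<Rightarrow> 'a set \<Rightarrow> 'a diffeology" where
  "sub_diff D Y n U f \<longleftrightarrow> D n U f \<and> f ` U \<subseteq> Y"

definition prod_diff :: "'a diffeology \<Rightarrow> 'b diffeology \<Rightarrow> ('a \<times> 'b) diffeology" where
  "prod_diff D1 D2 n U f \<longleftrightarrow> D1 n U (fst \<circ> f) \<and> D2 n U (snd \<circ> f)"

text \<open>The push-forward along \<open>q\<close>, seen as a surjection onto its image.\<close>

definition push_diff :: "'a diffeology \<Rightarrow> ('a \<Rightarrow> 'b) \<Rightarrow> 'b diffeology" where
  "push_diff D q n U f \<longleftrightarrow> openin (Euclidean_space n) U \<and>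
     (\<forall>x\<in>U. \<exists>V p. openin (Euclidean_space n) V \<and> x \<in> V \<and> V \<subseteq> U \<and> D n V p \<and> (\<forall>y\<in>V. f y = q (p y)))"

text \<open>
  Scalars: a commutative normed field which is a finite-dimensional real vector space
  is isomorphic to the field of real or of complex numbers, and both \<^typ>\<open>real\<close> and
  \<^typ>\<open>complex\<close> have the sort \<open>{real_normed_field, euclidean_space}\<close>.
  They carry their usual smooth structure.
\<close>

definition scalar_diff :: "'k::{real_normed_field, euclidean_space} diffeology" where
  "scalar_diff n U f \<longleftrightarrow> openin (Euclidean_space n) U \<and> (\<forall>b\<in>Basis. C_inf n U (\<lambda>x. f x \<bullet> b))"


section \<open>Diffeological vector spaces, algebras and actions\<close>

locale diffeological_vector_space =
  vector_space scaleE + diffeological_space "UNIV :: 'e set" DE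
  for scaleE :: "'k::{real_normed_field, euclidean_space} \<Rightarrow> 'e::ab_group_add \<Rightarrow> 'e"
    and DE :: "'e diffeology" +
  assumes smooth_add: "diff_smooth (prod_diff DE DE) DE (\<lambda>(x, y). x + y)"
    and smooth_scaleE: "diff_smooth (prod_diff scalar_diff DE) DE (\<lambda>(c, x). scaleE c x)"

text \<open>
  The algebra is given with an explicit carrier, so that it may be an algebra such as \<open>L(E)\<close>
  whose elements depend on the diffeology of \<open>E\<close>.
\<close>

locale diffeological_algebra =
  ring A + diffeological_space "carrier A" DA
  for A :: "('a, 'm) ring_scheme" (structure)
    and scaleA :: "'k::{real_normed_field, euclidean_space} \<Rightarrow> 'a \<Rightarrow> 'a"
    and DA :: "'a diffeology" +
  assumes scaleA_closed: "a \<in> carrier A \<Longrightarrow> scaleA c a \<in> carrier A"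
    and scaleA_right_distrib: "a \<in> carrier A \<Longrightarrow> b \<in> carrier A \<Longrightarrow>
      scaleA c (a \<oplus> b) = scaleA c a \<oplus> scaleA c b"
    and scaleA_left_distrib: "a \<in> carrier A \<Longrightarrow> scaleA (c + d) a = scaleA c a \<oplus> scaleA d a"
    and scaleA_scaleA: "a \<in> carrier A \<Longrightarrow> scaleA c (scaleA d a) = scaleA (c * d) a"
    and scaleA_one: "a \<in> carrier A \<Longrightarrow> scaleA 1 a = a"
    and scaleA_mult_left: "a \<in> carrier A \<Longrightarrow> b \<in> carrier A \<Longrightarrow>
      scaleA c a \<otimes> b = scaleA c (a \<otimes> b)"
    and scaleA_mult_right: "a \<in> carrier A \<Longrightarrow> b \<in> carrier A \<Longrightarrow>
      a \<otimes> scaleA c b = scaleA c (a \<otimes> b)"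
    and smooth_addA: "diff_smooth (prod_diff DA DA) DA (\<lambda>(a, b). a \<oplus> b)"
    and smooth_multA: "diff_smooth (prod_diff DA DA) DA (\<lambda>(a, b). a \<otimes> b)"
    and smooth_scaleA: "diff_smooth (prod_diff scalar_diff DA) DA (\<lambda>(c, a). scaleA c a)"

locale diffeological_action =
  E: diffeological_vector_space scaleE DE + A: diffeological_algebra A scaleA DA
  for scaleE :: "'k::{real_normed_field, euclidean_space} \<Rightarrow> 'e::ab_group_add \<Rightarrow> 'e"
    and DE :: "'e diffeology"
    and A :: "('a, 'm) ring_scheme" (structure)
    and scaleA :: "'k \<Rightarrow> 'a \<Rightarrow> 'a"
    and DA :: "'a diffeology" +
  fixes act :: "'a \<Rightarrow> 'e \<Rightarrow> 'e"
  assumes act_linear: "a \<in> carrier A \<Longrightarrow> Vector_Spaces.linear scaleE scaleE (act a)"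
    and act_add: "a \<in> carrier A \<Longrightarrow> b \<in> carrier A \<Longrightarrow> act (a \<oplus> b) x = act a x + act b x"
    and act_scale: "a \<in> carrier A \<Longrightarrow> act (scaleA c a) x = scaleE c (act a x)"
    and act_mult: "a \<in> carrier A \<Longrightarrow> b \<in> carrier A \<Longrightarrow> act (a \<otimes> b) x = act a (act b x)"
    and act_one: "act \<one> x = x"
    and smooth_act: "diff_smooth (prod_diff DA DE) DE (\<lambda>(a, x). act a x)"


section \<open>The spaces \<open>L(E)\<close> and \<open>GL(E)\<close>\<close>

definition L_space ::
  "('k::{real_normed_field, euclidean_space} \<Rightarrow> 'e::ab_group_add \<Rightarrow> 'e) \<Rightarrow> 'e diffeology \<Rightarrow> ('e \<Rightarrow> 'e) set" where
  "L_space scaleE DE = {f. Vector_Spaces.linear scaleE scaleE f \<and> diff_smooth DE DE f}"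

text \<open>
  Pairs \<open>(x, y)\<close> with \<open>x\<close> of dimension \<open>m\<close> and \<open>y\<close> of dimension \<open>n\<close> are
  concatenated to a single vector \<open>z\<close> of dimension \<open>m + n\<close>.
\<close>

definition fst_part :: "nat \<Rightarrow> (nat \<Rightarrow> real) \<Rightarrow> (nat \<Rightarrow> real)" where
  "fst_part m z = (\<lambda>i. if i < m then z i else 0)"

definition snd_part :: "nat \<Rightarrow> (nat \<Rightarrow> real) \<Rightarrow> (nat \<Rightarrow> real)" where
  "snd_part m z = (\<lambda>i. z (m + i))"

definition concat_set :: "nat \<Rightarrow> (nat \<Rightarrow> real) set \<Rightarrow> (nat \<Rightarrow> real) set \<Rightarrow> (nat \<Rightarrow> real) set" where
  "concat_set m V U = {z. fst_part m z \<in> V \<and> snd_part m z \<in> U}"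

definition L_diff ::
  "('k::{real_normed_field, euclidean_space} \<Rightarrow> 'e::ab_group_add \<Rightarrow> 'e) \<Rightarrow> 'e diffeology \<Rightarrow> ('e \<Rightarrow> 'e) diffeology" where
  "L_diff scaleE DE n U \<rho> \<longleftrightarrow>
     openin (Euclidean_space n) U \<and> \<rho> ` U \<subseteq> L_space scaleE DE \<and>
     (\<forall>m V c. DE m V c \<longrightarrow>
        DE (m + n) (concat_set m V U) (\<lambda>z. \<rho> (snd_part m z) (c (fst_part m z))))"

definition GL_space ::
  "('k::{real_normed_field, euclidean_space} \<Rightarrow> 'e::ab_group_add \<Rightarrow> 'e) \<Rightarrow> 'e diffeology \<Rightarrow> ('e \<Rightarrow> 'e) set" where
  "GL_space scaleE DE =
     {g. Vector_Spaces.linear scaleE scaleE g \<and> bij g \<and>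
         diff_smooth DE DE g \<and> diff_smooth DE DE (inv_into UNIV g)}"

definition GL_diff ::
  "('k::{real_normed_field, euclidean_space} \<Rightarrow> 'e::ab_group_add \<Rightarrow> 'e) \<Rightarrow> 'e diffeology \<Rightarrow> ('e \<Rightarrow> 'e) diffeology" where
  "GL_diff scaleE DE n U g \<longleftrightarrow>
     g ` U \<subseteq> GL_space scaleE DE \<and> L_diff scaleE DE n U g \<and> L_diff scaleE DE n U (\<lambda>y. inv_into UNIV (g y))"


section \<open>Splittings and admissible couples\<close>

definition idempotents :: "('a, 'm) ring_scheme \<Rightarrow> 'a set" where
  "idempotents A = {p \<in> carrier A. p \<otimes>\<^bsub>A\<^esub> p = p}"

definition im_ker :: "('a \<Rightarrow> 'e \<Rightarrow> 'e::ab_group_add) \<Rightarrow> 'a \<Rightarrow> 'e set \<times> 'e set" where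
  "im_ker act p = (range (act p), {x. act p x = 0})"

definition Spl ::
  "('k::{real_normed_field, euclidean_space} \<Rightarrow> 'e::ab_group_add \<Rightarrow> 'e) \<Rightarrow> ('a, 'm) ring_scheme \<Rightarrow> ('a \<Rightarrow> 'e \<Rightarrow> 'e)
    \<Rightarrow> ('e set \<times> 'e set) set" where
  "Spl scaleE A act =
     {(V, W). module.subspace scaleE V \<and> module.subspace scaleE W \<and>
        (\<exists>p\<in>idempotents A. (V, W) = im_ker act p)}"

definition Spl_diff ::
  "('a, 'm) ring_scheme \<Rightarrow> 'a diffeology \<Rightarrow> ('a \<Rightarrow> 'e \<Rightarrow> 'e::ab_group_add) \<Rightarrow> ('e set \<times> 'e set) diffeology" where
  "Spl_diff A DA act = push_diff (sub_diff DA (idempotents A)) (im_ker act)"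

definition Adm ::
  "('k::{real_normed_field, euclidean_space} \<Rightarrow> 'e::ab_group_add \<Rightarrow> 'e) \<Rightarrow> ('a, 'm) ring_scheme \<Rightarrow> ('a \<Rightarrow> 'e \<Rightarrow> 'e)
    \<Rightarrow> (('e set \<times> 'e set) \<times> ('e set \<times> 'e set)) set" where
  "Adm scaleE A act =
     {((V1, W1), (V2, W2)) | V1 W1 V2 W2.
        ((V1, W1), (V2, W2)) \<in> Spl scaleE A act \<times> Spl scaleE A act \<and>
        ((V1, W2), (V2, W1)) \<in> Spl scaleE A act \<times> Spl scaleE A act}"

definition Adm_diff ::
  "('k::{real_normed_field, euclidean_space} \<Rightarrow> 'e::ab_group_add \<Rightarrow> 'e) \<Rightarrow> ('a, 'm) ring_scheme \<Rightarrow> 'a diffeology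
    \<Rightarrow> ('a \<Rightarrow> 'e \<Rightarrow> 'e) \<Rightarrow> (('e set \<times> 'e set) \<times> ('e set \<times> 'e set)) diffeology" where
  "Adm_diff scaleE A DA act =
     sub_diff (prod_diff (Spl_diff A DA act) (Spl_diff A DA act)) (Adm scaleE A act)"


section \<open>The maps built from projections\<close>

text \<open>The projection onto \<open>V\<close> parallel to \<open>W\<close>, meaningful when \<open>E\<close> is the direct sum of \<open>V\<close> and \<open>W\<close>.\<close>

definition proj_along :: "'e set \<times> 'e set \<Rightarrow> 'e \<Rightarrow> 'e::ab_group_add" where
  "proj_along = (\<lambda>(V, W) x. THE v. v \<in> V \<and> x - v \<in> W)"

definition DV :: "'e set \<Rightarrow> 'e set \<Rightarrow> 'e set \<Rightarrow> 'e set \<Rightarrow> 'e \<Rightarrow> 'e::ab_group_add" where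
  "DV V1 W1 V2 W2 = restrict (proj_along (V1, W2) \<circ> proj_along (V2, W1)) V1"

definition Phi :: "('e set \<times> 'e set) \<times> ('e set \<times> 'e set) \<Rightarrow> 'e \<Rightarrow> 'e::ab_group_add" where
  "Phi = (\<lambda>((V1, W1), (V2, W2)). DV V1 W1 V2 W2 \<circ> proj_along (V1, W1))"

definition DV_tilde :: "('e set \<times> 'e set) \<times> ('e set \<times> 'e set) \<Rightarrow> 'e \<Rightarrow> 'e::ab_group_add" where
  "DV_tilde = (\<lambda>((V1, W1), (V2, W2)) x. Phi ((V1, W1), (V2, W2)) x + Phi ((W1, V1), (W2, V2)) x)"

definition Xi :: "('e set \<times> 'e set) \<times> ('e set \<times> 'e set) \<Rightarrow> 'e \<Rightarrow> 'e::ab_group_add" where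
  "Xi = (\<lambda>((V1, W1), (V2, W2)). DV_tilde ((V1, W1), (V2, W2)) \<circ> DV_tilde ((V1, W2), (V2, W1)))"

end

theory Submission
  imports Defs
begin

text \<open>
  The map \<open>\<Xi>\<close> is the identity of \<open>E\<close> at every admissible couple; invertibility, the
  behaviour on \<open>V\<^sub>1\<close> and smoothness all follow from this. Composing smooth
  maps would not give the smoothness: \<open>\<Xi>\<close> is built from projections such as
  \<open>p\<^bsub>(V\<^sub>1, W\<^sub>2)\<^esub>\<close>, and computing that one from \<open>p\<^bsub>(V\<^sub>1, W\<^sub>1)\<^esub>\<close> and \<open>p\<^bsub>(V\<^sub>2, W\<^sub>2)\<^esub>\<close>
  involves an inverse, whereas inversion need not be smooth.

  Two projections with the same kernel satisfy \<open>p p' = p\<close>, two with the same image satisfy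
  \<open>p p' = p'\<close>. Let \<open>q\<close> and \<open>r\<close> be the projections attached to \<open>(V\<^sub>2, W\<^sub>1)\<close> and
  \<open>(V\<^sub>1, W\<^sub>2)\<close>. The first rule turns the definition of \<open>T = DV_tilde ((V\<^sub>1, W\<^sub>1), (V\<^sub>2, W\<^sub>2))\<close>
  into \<open>T = r q + (1 - q) (1 - r)\<close>, which is symmetric in \<open>q\<close> and \<open>r\<close>, as both \<open>T\<close> and
  \<open>q r + (1 - r) (1 - q)\<close> expand to \<open>1 - q - r + q r + r q\<close> (lemma \<open>DV_tilde_eq_conn\<close>).
  In the same way, with the projections \<open>p\<close>, \<open>s\<close> attached to \<open>(V\<^sub>1, W\<^sub>1)\<close> and
  \<open>(V\<^sub>2, W\<^sub>2)\<close>, the second factor of \<open>\<Xi>\<close> is \<open>p s + (1 - s) (1 - p)\<close>. Using the first form of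
  \<open>T\<close> on \<open>p s\<close> and the second one on \<open>(1 - s) (1 - p)\<close>, the two rules collapse the products
  to \<open>r\<close> and \<open>1 - r\<close>, whose sum is \<open>1\<close> (lemma \<open>conn_comp_conn\<close>).
\<close>

section \<open>Projections along complementary subgroups\<close>

text \<open>
  The group is the direct sum of its subgroups \<open>V\<close> and \<open>W\<close>. Closure under subtraction is
  the whole subgroup axiom here, because the last clause makes \<open>V\<close> and \<open>W\<close> nonempty.
\<close>

definition complementary :: "'e::ab_group_add set \<Rightarrow> 'e set \<Rightarrow> bool" where
  "complementary V W \<longleftrightarrow>
     (\<forall>x\<in>V. \<forall>y\<in>V. x - y \<in> V) \<and> (\<forall>x\<in>W. \<forall>y\<in>W. x - y \<in> W) \<and>
     (\<forall>x. \<exists>!v. v \<in> V \<and> x - v \<in> W)"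

lemma complementary_add_closed:
  assumes "complementary V W"
  shows "x \<in> V \<Longrightarrow> y \<in> V \<Longrightarrow> x + y \<in> V" and "x \<in> W \<Longrightarrow> y \<in> W \<Longrightarrow> x + y \<in> W"
proof -
  have *: "x + y \<in> S" if S: "\<forall>x\<in>S. \<forall>y\<in>S. x - y \<in> S" and "x \<in> S" "y \<in> S" for S :: "'a set"
  proof -
    have "x - ((y - y) - y) \<in> S" using that by blast
    then show ?thesis by simp
  qed
  show "x \<in> V \<Longrightarrow> y \<in> V \<Longrightarrow> x + y \<in> V" "x \<in> W \<Longrightarrow> y \<in> W \<Longrightarrow> x + y \<in> W"
    using assms * unfolding complementary_def by blast+
qed

lemma proj_along_eqI:
  assumes "complementary V W" "v \<in> V" "x - v \<in> W"
  shows "proj_along (V, W) x = v"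
proof -
  have "\<exists>!v. v \<in> V \<and> x - v \<in> W" using assms(1) by (simp add: complementary_def)
  then show ?thesis
    unfolding proj_along_def using assms(2,3) by (simp add: the1_equality)
qed

lemma proj_along_mem:
  assumes "complementary V W"
  shows "proj_along (V, W) x \<in> V" and "x - proj_along (V, W) x \<in> W"
proof -
  obtain v where v: "v \<in> V" "x - v \<in> W"
    using assms unfolding complementary_def by blast
  with assms have "proj_along (V, W) x = v" by (intro proj_along_eqI)
  with v show "proj_along (V, W) x \<in> V" "x - proj_along (V, W) x \<in> W" by simp_all
qed

lemma proj_along_add:
  assumes "complementary V W"
  shows "proj_along (V, W) (x + y) = proj_along (V, W) x + proj_along (V, W) y"
proof (rule proj_along_eqI[OF assms])
  show "proj_along (V, W) x + proj_along (V, W) y \<in> V"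
    by (intro complementary_add_closed[OF assms] proj_along_mem[OF assms])
  have "(x - proj_along (V, W) x) + (y - proj_along (V, W) y) \<in> W"
    by (intro complementary_add_closed[OF assms] proj_along_mem[OF assms])
  then show "x + y - (proj_along (V, W) x + proj_along (V, W) y) \<in> W"
    by (simp add: algebra_simps)
qed

lemma proj_along_diff:
  assumes "complementary V W"
  shows "proj_along (V, W) (x - y) = proj_along (V, W) x - proj_along (V, W) y"
  using proj_along_add[OF assms, of "x - y" y] by simp

lemma complementary_sym:
  assumes "complementary V W"
  shows "complementary W V"
proof -
  have "\<exists>!w. w \<in> W \<and> x - w \<in> V" for x
  proof -
    obtain v where v: "v \<in> V" "x - v \<in> W"
      and uniq: "\<And>v'. v' \<in> V \<Longrightarrow> x - v' \<in> W \<Longrightarrow> v' = v"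
      using assms unfolding complementary_def by blast
    show ?thesis
    proof (rule ex1I[of _ "x - v"])
      show "x - v \<in> W \<and> x - (x - v) \<in> V" using v by simp
      show "w = x - v" if "w \<in> W \<and> x - w \<in> V" for w
        using uniq[of "x - w"] that by (simp add: algebra_simps)
    qed
  qed
  with assms show ?thesis unfolding complementary_def by blast
qed

lemma proj_along_swap:
  assumes "complementary V W"
  shows "proj_along (W, V) x = x - proj_along (V, W) x"
  by (rule proj_along_eqI[OF complementary_sym[OF assms]])
    (use proj_along_mem[OF assms] in simp_all)

lemma proj_along_same_kernel:
  assumes VW: "complementary V W" and V'W: "complementary V' W"
  shows "proj_along (V, W) (proj_along (V', W) x) = proj_along (V, W) x"
proof (rule proj_along_eqI[OF VW proj_along_mem(1)[OF VW]])
  have "(x - proj_along (V, W) x) - (x - proj_along (V', W) x) \<in> W"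
    using proj_along_mem(2)[OF VW] proj_along_mem(2)[OF V'W] VW
    unfolding complementary_def by blast
  then show "proj_along (V', W) x - proj_along (V, W) x \<in> W" by simp
qed

lemma proj_along_same_image:
  assumes VW: "complementary V W" and VW': "complementary V W'"
  shows "proj_along (V, W) (proj_along (V, W') x) = proj_along (V, W') x"
proof (rule proj_along_eqI[OF VW proj_along_mem(1)[OF VW']])
  have "proj_along (V, W) x - proj_along (V, W) x \<in> V"
    "(x - proj_along (V, W) x) - (x - proj_along (V, W) x) \<in> W"
    using VW proj_along_mem[OF VW] unfolding complementary_def by blast+
  then show "proj_along (V, W') x - proj_along (V, W') x \<in> W" by simp
qed


section \<open>The map \<open>\<Xi>\<close> is the identity\<close>

text \<open>
  For idempotents \<open>q\<close> and \<open>r\<close> this is \<open>1 - (q - r)\<^sup>2\<close>. It is the expansion both of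
  \<open>r q + (1 - q) (1 - r)\<close> and of \<open>q r + (1 - r) (1 - q)\<close>.
\<close>

definition conn :: "('e \<Rightarrow> 'e) \<Rightarrow> ('e \<Rightarrow> 'e) \<Rightarrow> 'e \<Rightarrow> 'e::ab_group_add" where
  "conn q r x = x - q x - r x + q (r x) + r (q x)"

text \<open>
  The inner projections onto \<open>V\<^sub>1\<close> and \<open>W\<^sub>1\<close> in the definition of \<open>DV_tilde\<close> are absorbed: what
  they discard is killed anyway by the next projection, which has the same kernel.
\<close>

lemma DV_tilde_eq_conn:
  assumes c11: "complementary V1 W1"
    and c12: "complementary V1 W2" and c21: "complementary V2 W1"
  shows "DV_tilde ((V1, W1), (V2, W2)) = conn (proj_along (V2, W1)) (proj_along (V1, W2))"
proof
  fix x
  note c11' = complementary_sym[OF c11]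
  note c12' = complementary_sym[OF c12] and c21' = complementary_sym[OF c21]
  have "DV_tilde ((V1, W1), (V2, W2)) x =
      proj_along (V1, W2) (proj_along (V2, W1) (proj_along (V1, W1) x)) +
      proj_along (W1, V2) (proj_along (W2, V1) (proj_along (W1, V1) x))"
    by (simp add: DV_tilde_def Phi_def DV_def proj_along_mem(1)[OF c11] proj_along_mem(1)[OF c11'])
  also have "\<dots> = proj_along (V1, W2) (proj_along (V2, W1) x) +
      proj_along (W1, V2) (proj_along (W2, V1) x)"
    by (simp add: proj_along_same_kernel[OF c21 c11] proj_along_same_kernel[OF c12' c11'])
  also have "\<dots> = conn (proj_along (V2, W1)) (proj_along (V1, W2)) x"
    by (simp add: conn_def proj_along_swap[OF c12] proj_along_swap[OF c21]
        proj_along_diff[OF c21] algebra_simps)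
  finally show "DV_tilde ((V1, W1), (V2, W2)) x =
    conn (proj_along (V2, W1)) (proj_along (V1, W2)) x" .
qed

text \<open>
  The case in view is that \<open>q\<close>, \<open>r\<close>, \<open>p\<close>, \<open>s\<close> are the projections attached to
  \<open>(V\<^sub>2, W\<^sub>1)\<close>, \<open>(V\<^sub>1, W\<^sub>2)\<close>, \<open>(V\<^sub>1, W\<^sub>1)\<close>, \<open>(V\<^sub>2, W\<^sub>2)\<close>: then \<open>q\<close>, \<open>p\<close> have a common
  kernel, and so do \<open>r\<close>, \<open>s\<close>, while \<open>r\<close>, \<open>p\<close> have a common image, and so do \<open>q\<close>, \<open>s\<close>.
\<close>

lemma conn_comp_conn:
  fixes p q r s :: "'e::ab_group_add \<Rightarrow> 'e"
  assumes q_diff: "\<And>x y. q (x - y) = q x - q y" and r_diff: "\<And>x y. r (x - y) = r x - r y"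
    and p_diff: "\<And>x y. p (x - y) = p x - p y" and s_diff: "\<And>x y. s (x - y) = s x - s y"
    and qp: "\<And>x. q (p x) = q x" and rs: "\<And>x. r (s x) = r x"
    and rp: "\<And>x. r (p x) = p x" and qs: "\<And>x. q (s x) = s x"
  shows "conn q r (conn s p x) = x"
proof -
  \<comment> \<open>the two factorisations of \<open>conn q r\<close>\<close>
  have fact1: "conn q r y = r (q y) + ((y - r y) - q (y - r y))" for y
    by (simp add: conn_def q_diff algebra_simps)
  have fact2: "conn q r y = q (r y) + ((y - q y) - r (y - q y))" for y
    by (simp add: conn_def r_diff algebra_simps)
  define a where "a = p (s x)"
  define b where "b = (x - p x) - s (x - p x)"
  have conn_ab: "conn s p x = a + b"
    by (simp add: conn_def a_def b_def s_diff algebra_simps)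
  have q0: "q 0 = 0" and r0: "r 0 = 0"
    using q_diff[of 0 0] r_diff[of 0 0] by simp_all
  have add: "q (y + z) = q y + q z" "r (y + z) = r y + r z" for y z
    using q_diff[of "y + z" z] r_diff[of "y + z" z] by simp_all
  have "conn q r a = r x"
    by (simp add: fact1 a_def rp qp qs rs q0)
  moreover have "conn q r b = x - r x"
  proof -
    have "r b = 0" by (simp add: b_def r_diff rs)
    moreover have "b - q b = x - p x" by (simp add: b_def q_diff qs qp)
    ultimately show ?thesis by (simp add: fact2 q0 r_diff rp)
  qed
  moreover have "conn q r (a + b) = conn q r a + conn q r b"
    by (simp add: conn_def add algebra_simps)
  ultimately show ?thesis by (simp add: conn_ab)
qed

theorem Xi_eq_id:
  assumes c11: "complementary V1 W1" and c22: "complementary V2 W2"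
    and c12: "complementary V1 W2" and c21: "complementary V2 W1"
  shows "Xi ((V1, W1), (V2, W2)) = id"
proof
  fix x
  show "Xi ((V1, W1), (V2, W2)) x = id x"
    by (simp add: Xi_def DV_tilde_eq_conn[OF c11 c12 c21] DV_tilde_eq_conn[OF c12 c11 c22])
      (intro conn_comp_conn proj_along_diff proj_along_same_kernel proj_along_same_image assms)
qed

lemma (in diffeological_action) Spl_complementary:
  assumes "(V, W) \<in> Spl scaleE A act"
  shows "complementary V W"
proof -
  from assms obtain p where p: "p \<in> carrier A" "p \<otimes> p = p"
    and V: "V = range (act p)" and W: "W = {x. act p x = 0}"
    and sub: "E.subspace V" "E.subspace W"
    by (auto simp: Spl_def idempotents_def im_ker_def)
  interpret p: Vector_Spaces.linear scaleE scaleE "act p"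
    by (rule act_linear[OF p(1)])
  have idem: "act p (act p x) = act p x" for x
    using act_mult[OF p(1) p(1), of x] p(2) by simp
  have "\<exists>!v. v \<in> V \<and> x - v \<in> W" for x
  proof (rule ex1I[of _ "act p x"])
    show "act p x \<in> V \<and> x - act p x \<in> W"
      by (simp add: V W p.diff idem)
    show "v = act p x" if "v \<in> V \<and> x - v \<in> W" for v
      using that by (auto simp: V W p.diff idem)
  qed
  with sub show ?thesis
    by (simp add: complementary_def E.subspace_diff)
qed

lemma (in diffeological_action) Xi_eq_id_of_Adm:
  assumes "c \<in> Adm scaleE A act"
  shows "Xi c = id"
  using assms by (auto simp: Adm_def intro!: Xi_eq_id Spl_complementary)


section \<open>The identity as a constant plot\<close>

text \<open>
  That a constant map into \<open>GL(E)\<close> with value the identity is a plot means that a plot of \<open>E\<close>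
  stays one when dummy coordinates are appended; this rests on the smoothness of
  \<open>fst_part\<close>.
\<close>

lemma C_k_const: "C_k k n U (\<lambda>_. c)"
proof (induction k arbitrary: c)
  case (Suc k)
  have "\<exists>g. (\<forall>x\<in>U. ((\<lambda>t. c) has_real_derivative g x) (at (x i))) \<and> C_k k n U g" for i
    by (rule exI[of _ "\<lambda>_. 0"]) (simp add: Suc.IH)
  then show ?case by simp
qed simp

lemma continuous_map_Euclidean_space_coord:
  "continuous_map (Euclidean_space n) euclideanreal (\<lambda>x. x i)"
  unfolding Euclidean_space_def
  by (intro continuous_map_from_subtopology continuous_map_product_projection) simp

lemma C_k_coord: "C_k k n U (\<lambda>x. x i)"
proof (cases k)
  case (Suc l)
  have "\<exists>g. (\<forall>x\<in>U. ((\<lambda>t. (x(j := t)) i) has_real_derivative g x) (at (x j))) \<and> C_k l n U g"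
    for j
    by (rule exI[of _ "\<lambda>_. if i = j then 1 else 0"]) (auto simp: C_k_const)
  then show ?thesis
    by (simp add: Suc continuous_map_from_subtopology continuous_map_Euclidean_space_coord)
qed (simp add: continuous_map_from_subtopology continuous_map_Euclidean_space_coord)

lemma continuous_map_fst_part:
  "continuous_map (Euclidean_space (m + n)) (Euclidean_space m) (fst_part m)"
proof -
  have "continuous_map (Euclidean_space (m + n)) (powertop_real UNIV) (fst_part m)"
    unfolding continuous_map_componentwise_UNIV fst_part_def
    using continuous_map_Euclidean_space_coord[of "m + n"] by simp
  then show ?thesis
    by (auto simp: Euclidean_space_def[of m] continuous_map_in_subtopology fst_part_def)
qed

lemma continuous_map_snd_part:
  "continuous_map (Euclidean_space (m + n)) (Euclidean_space n) (snd_part m)"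
proof -
  have "continuous_map (Euclidean_space (m + n)) (powertop_real UNIV) (snd_part m)"
    unfolding continuous_map_componentwise_UNIV snd_part_def
    using continuous_map_Euclidean_space_coord[of "m + n"] by simp
  then show ?thesis
    by (auto simp: Euclidean_space_def[of n] continuous_map_in_subtopology snd_part_def
        topspace_Euclidean_space)
qed

lemma openin_concat_set:
  assumes V: "openin (Euclidean_space m) V" and U: "openin (Euclidean_space n) U"
  shows "openin (Euclidean_space (m + n)) (concat_set m V U)"
proof -
  \<comment> \<open>membership in \<open>concat_set\<close> already forces the coordinates from \<open>m + n\<close> on to vanish\<close>
  have "z i = 0" if z: "z \<in> concat_set m V U" and i: "m + n \<le> i" for z i
  proof -
    have "snd_part m z (i - m) = 0"
      using z i openin_subset[OF U] by (auto simp: concat_set_def topspace_Euclidean_space)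
    with i show ?thesis by (simp add: snd_part_def)
  qed
  then have "concat_set m V U \<subseteq> topspace (Euclidean_space (m + n))"
    by (auto simp: topspace_Euclidean_space)
  then have "concat_set m V U =
      {z \<in> topspace (Euclidean_space (m + n)). fst_part m z \<in> V} \<inter>
      {z \<in> topspace (Euclidean_space (m + n)). snd_part m z \<in> U}"
    by (auto simp: concat_set_def)
  then show ?thesis
    by (simp only:) (intro openin_Int
        openin_continuous_map_preimage[OF continuous_map_fst_part V]
        openin_continuous_map_preimage[OF continuous_map_snd_part U])
qed

lemma C_inf_map_fst_part:
  assumes V: "openin (Euclidean_space m) V" and U: "openin (Euclidean_space n) U"
  shows "C_inf_map (m + n) (concat_set m V U) m V (fst_part m)"
  using openin_concat_set[OF assms] V
  by (auto simp: C_inf_map_def C_inf_def fst_part_def C_k_coord)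
    (auto simp: concat_set_def fst_part_def)

context diffeological_vector_space
begin

lemma id_in_GL_space: "id \<in> GL_space scaleE DE"
  by (simp add: GL_space_def linear_id diff_smooth_def)

text \<open>
  The hypothesis on \<open>g\<close> concerns \<open>U\<close> only, because \<open>Xi \<circ> c\<close> is under control only where the
  plot \<open>c\<close> of couples takes admissible values.
\<close>

lemma GL_diff_id:
  assumes U: "openin (Euclidean_space n) U" and g: "\<And>y. y \<in> U \<Longrightarrow> g y = id"
  shows "GL_diff scaleE DE n U g"
proof -
  have L: "L_diff scaleE DE n U h" if h: "\<And>y. y \<in> U \<Longrightarrow> h y = id" for h
  proof -
    have "DE (m + n) (concat_set m V U) (\<lambda>z. h (snd_part m z) (c (fst_part m z)))"
      if c: "DE m V c" for m V c
    proof (rule plot_cong)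
      show "DE (m + n) (concat_set m V U) (c \<circ> fst_part m)"
        by (rule plot_comp[OF c C_inf_map_fst_part[OF plot_open[OF c] U]])
    qed (simp add: concat_set_def h)
    then show ?thesis
      using U h id_in_GL_space by (auto simp: L_diff_def L_space_def GL_space_def)
  qed
  show ?thesis
    using L[of g] L[of "\<lambda>y. inv_into UNIV (g y)"] g id_in_GL_space
    by (auto simp: GL_diff_def)
qed

end


section \<open>Smoothness of \<open>\<Xi>\<close>\<close>

theorem theorem40:
  fixes scaleE :: "'k::{real_normed_field, euclidean_space} \<Rightarrow> 'e::ab_group_add \<Rightarrow> 'e"
    and DE :: "'e diffeology"
    and A :: "('a, 'm) ring_scheme"
    and scaleA :: "'k \<Rightarrow> 'a \<Rightarrow> 'a"
    and DA :: "'a diffeology"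
    and act :: "'a \<Rightarrow> 'e \<Rightarrow> 'e"
  assumes "diffeological_action scaleE DE A scaleA DA act"
  shows "(\<forall>V1 W1 V2 W2. ((V1, W1), (V2, W2)) \<in> Adm scaleE A act \<longrightarrow>
            Xi ((V1, W1), (V2, W2)) \<in> GL_space scaleE DE \<and>
            restrict (Xi ((V1, W1), (V2, W2))) V1 = restrict id V1) \<and>
         diff_smooth (Adm_diff scaleE A DA act) (GL_diff scaleE DE) Xi"
proof -
  interpret diffeological_action scaleE DE A scaleA DA act by (rule assms)
  have "GL_diff scaleE DE n U (Xi \<circ> c)" if "Adm_diff scaleE A DA act n U c" for n U c
  proof (rule E.GL_diff_id)
    show "openin (Euclidean_space n) U"
      using that by (simp add: Adm_diff_def sub_diff_def prod_diff_def Spl_diff_def push_diff_def)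
    show "(Xi \<circ> c) y = id" if "y \<in> U" for y
      using that \<open>Adm_diff scaleE A DA act n U c\<close>
      by (auto simp: Adm_diff_def sub_diff_def intro!: Xi_eq_id_of_Adm)
  qed
  then show ?thesis
    by (auto simp: diff_smooth_def Xi_eq_id_of_Adm E.id_in_GL_space)
qed

end
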